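(* Let $n\ge 1$ be an integer. Then \[ \dim(K_{1,1}\square K_{1,n})=\begin{cases}2 & \text{if } n=1,\\ n & \text{if } 2\le n\le 4,\\ n-1 & \text{if } n\ge 5.\end{cases} \]
   Context: All graphs are finite and simple; $d(u,v)$ is the length of a shortest path. For a connected graph $G$ and $W=\{w_1,\dots,w_k\}\subseteq V(G)$ (ordered), the metric representation of a vertex $v$ is $r(v|W)=(d(v,w_1),\dots,d(v,w_k))$. $W$ is a resolving set if distinct vertices of $G$ have distinct metric representations with respect to $W$. The metric dimension $\dim(G)$ is the minimum cardinality of a resolving set. $K_{1,n}$ is the star with $n$ leaves. The Cartesian product $G\square H$ has vertex set $V(G)\times V(H)$, with $(u,v)$ adjacent to $(u',v')$ iff $u=u'$ and $vv'\in E(H)$, or $v=v'$ and $uu'\in E(G)$. *)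

theory Defs
  imports "Graph_Theory.Graph_Theory"
begin

text \<open>A finite simple graph is a \<^locale>\<open>pair_graph\<close>: its arc relation is irreflexive and symmetric,
  and an undirected edge \<open>uv\<close> is the pair of arcs \<open>(u, v)\<close>, \<open>(v, u)\<close>.\<close>

text \<open>The library's minimal walk cost with unit weights is the length of a shortest path;
  it is \<open>\<infinity>\<close> if there is none.\<close>
definition graph_dist :: "'a pair_pre_digraph \<Rightarrow> 'a \<Rightarrow> 'a \<Rightarrow> ereal" where
  "graph_dist G u v = wf_digraph.\<mu> (with_proj G) (\<lambda>_. 1) u v"

definition metric_rep :: "'a pair_pre_digraph \<Rightarrow> 'a list \<Rightarrow> 'a \<Rightarrow> ereal list" where
  "metric_rep G ws v = map (graph_dist G v) ws"

text \<open>The list \<open>ws\<close> fixes an order on \<open>W\<close>; which order is chosen is immaterial.\<close>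
definition resolving_set :: "'a pair_pre_digraph \<Rightarrow> 'a set \<Rightarrow> bool" where
  "resolving_set G W \<longleftrightarrow> W \<subseteq> pverts G \<and>
    (\<exists>ws. distinct ws \<and> set ws = W \<and> inj_on (metric_rep G ws) (pverts G))"

definition metric_dim :: "'a pair_pre_digraph \<Rightarrow> nat" where
  "metric_dim G = (LEAST k. \<exists>W. resolving_set G W \<and> card W = k)"

definition cartesian_product ::
    "'a pair_pre_digraph \<Rightarrow> 'b pair_pre_digraph \<Rightarrow> ('a \<times> 'b) pair_pre_digraph"
    (infixr \<open>\<box>\<close> 70) where
  "G \<box> H = \<lparr> pverts = pverts G \<times> pverts H,
     parcs = {((u, v), (u', v')). (u, v) \<in> pverts G \<times> pverts H \<and> (u', v') \<in> pverts G \<times> pverts H \<and>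
       (u = u' \<and> (v, v') \<in> parcs H \<or> v = v' \<and> (u, u') \<in> parcs G)} \<rparr>"

text \<open>In particular the product is a well-formed digraph, as the locale assumption
  behind \<open>wf_digraph.\<mu>\<close> requires.\<close>
lemma pair_graph_cartesian_product:
  assumes "pair_graph G" "pair_graph H"
  shows "pair_graph (G \<box> H)"
proof -
  interpret G: pair_graph G by fact
  interpret H: pair_graph H by fact
  have fin: "finite (parcs (G \<box> H))"
    by (rule finite_subset[of _ "(pverts G \<times> pverts H) \<times> (pverts G \<times> pverts H)"])
       (auto simp: cartesian_product_def)
  show ?thesis
    by unfold_locales
       (use fin in \<open>auto simp: cartesian_product_def symmetric_def sym_def
          dest: G.arcs_symmetric H.arcs_symmetric G.no_loops' H.no_loops'\<close>)
qed

end

theory Submission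
  imports Defs
begin

text \<open>
  Write \<open>a\<close>, \<open>b\<close> for the vertices of \<open>K\<^sub>1\<^sub>,\<^sub>1\<close>, \<open>c\<close> for the centre of the star and \<open>L\<close> for its set of
  \<open>n\<close> leaves. The product consists of two copies (layers) of the star with corresponding
  vertices joined, and the distance of \<open>(x, p)\<close> and \<open>(y, q)\<close> is the star distance of \<open>p\<close> and \<open>q\<close>,
  plus one if the layers differ (\<open>graph_dist_prism\<close>).

  If a set \<open>W\<close> contains no vertex above either of two leaves \<open>l\<close> and \<open>m\<close>, it cannot tell
  \<open>(a, l)\<close> from \<open>(a, m)\<close>. Hence a resolving set meets all leaf fibres but at most one, and so
  has at least \<open>n - 1\<close> elements. If it has exactly \<open>n - 1\<close>, it consists of exactly one vertex above
  each leaf other than some \<open>l0\<close>, and the only possible confusions are between a centre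
  \<open>(x, c)\<close> and a leaf \<open>(y, l)\<close> in the other layer \<open>y\<close>. Such a pair is confused when \<open>W\<close> meets the
  layer \<open>x\<close> in no vertex and \<open>l = l0\<close>, or only in the vertex \<open>(x, l)\<close>. So \<open>W\<close> must have two vertices
  in each layer, which forces \<open>n - 1 \<ge> 4\<close> (\<open>two_in_each_layer\<close>).

  Conversely, one vertex above each leaf but one is enough if each layer gets at least two of
  them, which settles \<open>n \<ge> 5\<close>. For \<open>2 \<le> n \<le> 4\<close> the \<open>n\<close> leaves of a single layer resolve the graph: there is no missed leaf \<open>l0\<close>, so that the empty layer
  does no harm. Both constructions are instances of \<open>resolving_transversal\<close>. For \<open>n = 1\<close> the product
  is a 4-cycle, in which the two neighbours of a vertex are equidistant from it, while two adjacent
  vertices resolve the cycle.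
\<close>

section \<open>Distances, resolving sets and metric dimension\<close>

text \<open>
  Distances to \<open>v\<close> are certified by a potential: a function that drops by at most one along every
  arc bounds the length of a walk to \<open>v\<close> from below, and if every vertex other than \<open>v\<close> has an
  arc along which it drops by one, following these arcs gives a walk of that length.
\<close>

lemma graph_dist_eqI:
  fixes f :: "'a \<Rightarrow> nat"
  assumes "pair_wf_digraph G" "u \<in> pverts G" "v \<in> pverts G"
    and zero: "f v = 0"
    and le: "\<And>x y. (x, y) \<in> parcs G \<Longrightarrow> f x \<le> Suc (f y)"
    and step: "\<And>x. x \<in> pverts G \<Longrightarrow> x \<noteq> v \<Longrightarrow> \<exists>y. (x, y) \<in> parcs G \<and> f x = Suc (f y)"
  shows "graph_dist G u v = ereal (f u)"
proof -
  interpret pair_wf_digraph G by fact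
  have cost: "awalk_cost (\<lambda>_. 1) p = length p" for p :: "('a \<times> 'a) list"
    by (induct p) auto
  have lower: "f x \<le> length p" if "awalk x p v" for x p
    using that
  proof (induct p arbitrary: x)
    case Nil
    then show ?case using zero by (simp add: awalk_Nil_iff)
  next
    case (Cons e p)
    then have "e \<in> parcs G" "fst e = x" "f (snd e) \<le> length p"
      by (auto simp: awalk_Cons_iff)
    then show ?case using le[of x "snd e"] by (cases e) auto
  qed
  have attained: "\<exists>p. awalk x p v \<and> length p = f x" if "x \<in> pverts G" for x
    using that
  proof (induct "f x" arbitrary: x)
    case 0
    then have "x = v" using step by force
    then show ?case using 0 by (intro exI[of _ "[]"]) (simp add: awalk_Nil_iff)
  next
    case (Suc k)
    then have "x \<noteq> v" using zero by auto
    then obtain y where y: "(x, y) \<in> parcs G" "f x = Suc (f y)"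
      using step Suc.prems by blast
    then obtain p where "awalk y p v" "length p = f y"
      using Suc by (metis in_arcsD2 nat.inject)
    then show ?case using y Suc.prems
      by (intro exI[of _ "(x, y) # p"]) (auto simp: awalk_Cons_iff)
  qed
  obtain p where p: "awalk u p v" "length p = f u" using attained assms(2) by blast
  have "(INF p\<in>{p. awalk u p v}. ereal (length p)) = ereal (f u)"
  proof (rule antisym)
    show "(INF p\<in>{p. awalk u p v}. ereal (length p)) \<le> ereal (f u)"
      using p by (intro INF_lower2[of p]) auto
  qed (use lower in \<open>auto intro!: INF_greatest\<close>)
  then show ?thesis by (simp add: graph_dist_def \<mu>_def cost)
qed

lemma resolving_set_iff:
  assumes "finite (pverts G)"
  shows "resolving_set G W \<longleftrightarrow> W \<subseteq> pverts G \<and>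
    (\<forall>u\<in>pverts G. \<forall>v\<in>pverts G. (\<forall>w\<in>W. graph_dist G u w = graph_dist G v w) \<longrightarrow> u = v)"
proof (cases "W \<subseteq> pverts G")
  case True
  then have "\<exists>ws. distinct ws \<and> set ws = W"
    using assms finite_distinct_list finite_subset by metis
  then show ?thesis unfolding resolving_set_def inj_on_def metric_rep_def by auto
qed (simp add: resolving_set_def)

lemma metric_dim_eqI:
  assumes "resolving_set G W" "card W = k"
    and "\<And>V. resolving_set G V \<Longrightarrow> k \<le> card V"
  shows "metric_dim G = k"
  unfolding metric_dim_def using assms by (intro Least_equality) auto

section \<open>The prism over a star\<close>

locale star_prism =
  fixes G :: "'a pair_pre_digraph" and H :: "'b pair_pre_digraph"
    and a b :: 'a and c :: 'b and L :: "'b set"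
  assumes ab: "a \<noteq> b" and vertsG: "pverts G = {a, b}" and arcsG: "parcs G = {(a, b), (b, a)}"
    and cL: "c \<notin> L" and finL: "finite L" and vertsH: "pverts H = insert c L"
    and arcsH: "parcs H = {c} \<times> L \<union> L \<times> {c}"
begin

lemma pverts_prism: "pverts (G \<box> H) = {a, b} \<times> insert c L"
  by (simp add: cartesian_product_def vertsG vertsH)

lemma finite_prism: "finite (pverts (G \<box> H))"
  using finL by (simp add: pverts_prism)

lemma parcs_prism: "((x, p), (y, q)) \<in> parcs (G \<box> H) \<longleftrightarrow>
    x \<in> {a, b} \<and> y \<in> {a, b} \<and> p \<in> insert c L \<and> q \<in> insert c L \<and>
    (x = y \<and> (p = c \<and> q \<in> L \<or> p \<in> L \<and> q = c) \<or> p = q \<and> x \<noteq> y)"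
  using ab by (auto simp: cartesian_product_def vertsG vertsH arcsG arcsH)

definition star_dist :: "'b \<Rightarrow> 'b \<Rightarrow> nat" where
  "star_dist p q = (if p = q then 0 else if p = c \<or> q = c then 1 else 2)"

definition prism_dist :: "'a \<times> 'b \<Rightarrow> 'a \<times> 'b \<Rightarrow> nat" where
  "prism_dist u v = of_bool (fst u \<noteq> fst v) + star_dist (snd u) (snd v)"

text \<open>The potential drops along the rung into the layer of \<open>v\<close>; within that layer it drops along the
  star edge to the centre, or from the centre to \<open>v\<close>.\<close>

lemma graph_dist_prism:
  assumes "u \<in> {a, b} \<times> insert c L" "v \<in> {a, b} \<times> insert c L"
  shows "graph_dist (G \<box> H) u v = ereal (prism_dist u v)"
proof -
  obtain y q where v: "v = (y, q)" "y \<in> {a, b}" "q \<in> insert c L" using assms by auto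
  let ?f = "\<lambda>w. of_bool (fst w \<noteq> y) + star_dist (snd w) q"
  have wf: "pair_wf_digraph (G \<box> H)"
    by unfold_locales (auto simp: cartesian_product_def)
  have "graph_dist (G \<box> H) u v = ereal (?f u)"
  proof (rule graph_dist_eqI[OF wf])
    fix w z assume "(w, z) \<in> parcs (G \<box> H)"
    then show "?f w \<le> Suc (?f z)"
      using cL by (cases w, cases z) (auto simp: parcs_prism star_dist_def)
  next
    fix w assume "w \<in> pverts (G \<box> H)" "w \<noteq> v"
    then obtain x p where w: "w = (x, p)" "x \<in> {a, b}" "p \<in> insert c L" "(x, p) \<noteq> (y, q)"
      using v by (auto simp: pverts_prism)
    show "\<exists>z. (w, z) \<in> parcs (G \<box> H) \<and> ?f w = Suc (?f z)"
    proof (cases "x = y")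
      case False
      then show ?thesis
        using w v by (intro exI[of _ "(y, p)"]) (auto simp: parcs_prism)
    next
      case True
      then show ?thesis
        using w v cL
        by (intro exI[of _ "(y, if p = c then q else c)"]) (auto simp: parcs_prism star_dist_def)
    qed
  qed (use assms v in \<open>auto simp: pverts_prism star_dist_def\<close>)
  then show ?thesis using v by (simp add: prism_dist_def)
qed

lemma resolving_prism_iff: "resolving_set (G \<box> H) W \<longleftrightarrow> W \<subseteq> {a, b} \<times> insert c L \<and>
    (\<forall>u\<in>{a, b} \<times> insert c L. \<forall>v\<in>{a, b} \<times> insert c L. (\<forall>w\<in>W. prism_dist u w = prism_dist v w) \<longrightarrow> u = v)"
proof -
  have "graph_dist (G \<box> H) u w = graph_dist (G \<box> H) v w \<longleftrightarrow> prism_dist u w = prism_dist v w"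
    if "u \<in> {a, b} \<times> insert c L" "v \<in> {a, b} \<times> insert c L" "w \<in> {a, b} \<times> insert c L" for u v w
    using that by (simp only: graph_dist_prism ereal.inject of_nat_eq_iff)
  then show ?thesis
    unfolding resolving_set_iff[OF finite_prism] pverts_prism by (meson subsetD)
qed

lemma resolvingD:
  assumes "resolving_set (G \<box> H) W" "x \<in> {a, b}" "y \<in> {a, b}" "p \<in> insert c L" "q \<in> insert c L"
    and "\<And>z r. (z, r) \<in> W \<Longrightarrow> prism_dist (x, p) (z, r) = prism_dist (y, q) (z, r)"
  shows "x = y \<and> p = q"
proof -
  have "\<forall>w\<in>W. prism_dist (x, p) w = prism_dist (y, q) w" using assms(6) by auto
  moreover have "(x, p) \<in> {a, b} \<times> insert c L" "(y, q) \<in> {a, b} \<times> insert c L"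
    using assms(2-5) by (simp_all only: mem_Sigma_iff simp_thms)
  ultimately have "(x, p) = (y, q)"
    using assms(1)[unfolded resolving_prism_iff, THEN conjunct2] by (simp only: Ball_def)
  then show ?thesis by simp
qed

section \<open>Lower bounds\<close>

lemma resolving_subset: "resolving_set (G \<box> H) W \<Longrightarrow> W \<subseteq> {a, b} \<times> insert c L"
  by (simp add: resolving_prism_iff)

lemma resolving_finite: "resolving_set (G \<box> H) W \<Longrightarrow> finite W"
  using resolving_subset finL by (meson finite.intros finite_SigmaI finite_subset)

lemma missed_leaf_unique:
  assumes "resolving_set (G \<box> H) W" "l \<in> L - snd ` W" "m \<in> L - snd ` W"
  shows "l = m"
proof -
  have "a = a \<and> l = m"
  proof (rule resolvingD[OF assms(1)])
    fix z r assume "(z, r) \<in> W"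
    then have "r \<noteq> l" "r \<noteq> m" using assms(2,3) by force+
    then show "prism_dist (a, l) (z, r) = prism_dist (a, m) (z, r)"
      using assms(2,3) cL by (auto simp: prism_dist_def star_dist_def)
  qed (use assms in auto)
  then show ?thesis by simp
qed

lemma card_resolving_ge:
  assumes "resolving_set (G \<box> H) W"
  shows "card L - 1 \<le> card W"
proof -
  have "card (L - snd ` W) \<le> 1"
    using missed_leaf_unique[OF assms] finL by (auto simp: card_le_Suc0_iff_eq)
  moreover have "card L - card (snd ` W) \<le> card (L - snd ` W)"
    using resolving_finite[OF assms] by (intro diff_card_le_card_Diff) auto
  moreover have "card (snd ` W) \<le> card W"
    using resolving_finite[OF assms] by (rule card_image_le)
  ultimately show ?thesis by linarith
qed

text \<open>
  Every vertex has a neighbour in the other layer and one in its own layer, and it does not tell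
  these two apart.
\<close>

lemma card_resolving_ge_2:
  assumes "resolving_set (G \<box> H) W" "L \<noteq> {}"
  shows "2 \<le> card W"
proof (rule ccontr)
  assume "\<not> 2 \<le> card W"
  then have "\<forall>u\<in>W. \<forall>v\<in>W. u = v"
    using card_le_Suc0_iff_eq[OF resolving_finite[OF assms(1)]] by auto
  then obtain w where w: "w \<in> {a, b} \<times> insert c L" "W \<subseteq> {w}"
    using resolving_subset[OF assms(1)] by (cases "W = {}") blast+
  then obtain x p where xp: "x \<in> {a, b}" "p \<in> insert c L" "W \<subseteq> {(x, p)}"
    by (cases w) blast
  obtain y where y: "y \<in> {a, b}" "y \<noteq> x" using ab xp by auto
  obtain q where q: "q \<in> insert c L" "q \<noteq> p" "p = c \<or> q = c" using assms(2) cL by blast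
  have "x = y \<and> q = p"
    using xp y q by (intro resolvingD[OF assms(1)]) (auto simp: prism_dist_def star_dist_def)
  then show False using y by simp
qed

text \<open>
  A resolving set with \<open>n - 1\<close> elements has to spend all of them on \<open>n - 1\<close> different leaves, so
  that it contains neither a centre nor two vertices above the same leaf.
\<close>

lemma small_resolving_transversal:
  assumes W: "resolving_set (G \<box> H) W" and "L \<noteq> {}" "card W = card L - 1"
  obtains l0 where "l0 \<in> L" "snd ` W = L - {l0}" "inj_on snd W"
proof -
  note fin = resolving_finite[OF W]
  have "card (snd ` W) \<le> card W" using fin by (rule card_image_le)
  moreover have "card L > 0" using assms(2) finL by (simp add: card_gt_0_iff)
  ultimately have "card (snd ` W) < card L" using assms(3) by linarith
  then have "\<not> L \<subseteq> snd ` W" using fin by (meson card_mono finite_imageI not_le)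
  then obtain l0 where l0: "l0 \<in> L" "l0 \<notin> snd ` W" by blast
  then have sub: "L - {l0} \<subseteq> snd ` W" using missed_leaf_unique[OF W] by auto
  have "card (L - {l0}) = card W" using l0 finL assms(3) by simp
  then have eq: "L - {l0} = snd ` W"
    using sub fin \<open>card (snd ` W) \<le> card W\<close> by (intro card_seteq) auto
  then have "inj_on snd W"
    using fin \<open>card (L - {l0}) = card W\<close> by (intro eq_card_imp_inj_on) auto
  then show ?thesis using that l0 eq by simp
qed

text \<open>
  With at most one vertex of \<open>W\<close> in the layer \<open>x\<close>, the centre \<open>(x, c)\<close> is confused with a leaf of the
  other layer: the one opposite to that vertex, or the missed one if the layer contains no
  vertex of \<open>W\<close>.
\<close>

lemma two_in_each_layer:
  assumes W: "resolving_set (G \<box> H) W" and "L \<noteq> {}" "card W = card L - 1" and x: "x \<in> {a, b}"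
  shows "2 \<le> card {w \<in> W. fst w = x}"
proof (rule ccontr)
  assume "\<not> 2 \<le> card {w \<in> W. fst w = x}"
  then have "\<forall>u\<in>{w \<in> W. fst w = x}. \<forall>v\<in>{w \<in> W. fst w = x}. u = v"
    using resolving_finite[OF W] by (subst card_le_Suc0_iff_eq[symmetric]) auto
  then have one: "u = v" if "u \<in> W" "v \<in> W" "fst u = x" "fst v = x" for u v
    using that by blast
  obtain y where y: "y \<in> {a, b}" "y \<noteq> x" using ab x by auto
  have layers: "z = x \<or> z = y" if "(z, r) \<in> W" for z r
    using resolving_subset[OF W] that x y by auto
  obtain l0 where l0: "l0 \<in> L" "snd ` W = L - {l0}" "inj_on snd W"
    using small_resolving_transversal[OF W assms(2,3)] .
  have leaf: "r \<in> L \<and> r \<noteq> l0" if "(z, r) \<in> W" for z r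
    using that l0(2) by force
  obtain l where l: "l \<in> L" "\<And>z r. (z, r) \<in> W \<Longrightarrow> (r = l \<longleftrightarrow> z = x)"
  proof (cases "\<exists>l. (x, l) \<in> W")
    case True
    then obtain l where l: "(x, l) \<in> W" by blast
    then have "r = l \<longleftrightarrow> z = x" if "(z, r) \<in> W" for z r
      using that one[of "(x, l)" "(z, r)"] inj_onD[OF l0(3), of "(x, l)" "(z, r)"] by auto
    then show ?thesis using that[of l] leaf[OF l] by blast
  next
    case False
    then show ?thesis using that[of l0] leaf l0(1) by blast
  qed
  have "x = y \<and> c = l"
  proof (rule resolvingD[OF W])
    fix z r assume zr: "(z, r) \<in> W"
    then show "prism_dist (x, c) (z, r) = prism_dist (y, l) (z, r)"
      using layers[OF zr] l(2)[OF zr] leaf[OF zr] l(1) y cL by (auto simp: prism_dist_def star_dist_def)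
  qed (use x y l in auto)
  then show False using y by simp
qed

lemma five_leaves:
  assumes W: "resolving_set (G \<box> H) W" and "L \<noteq> {}" "card W = card L - 1"
  shows "5 \<le> card L"
proof -
  note fin = resolving_finite[OF W]
  have "card W \<ge> card ({w \<in> W. fst w = a} \<union> {w \<in> W. fst w = b})"
    using fin by (intro card_mono) auto
  also have "card ({w \<in> W. fst w = a} \<union> {w \<in> W. fst w = b}) =
      card {w \<in> W. fst w = a} + card {w \<in> W. fst w = b}"
    using fin ab by (intro card_Un_disjoint) auto
  finally show ?thesis
    using two_in_each_layer[OF assms, of a] two_in_each_layer[OF assms, of b] assms(3) by auto
qed

section \<open>Upper bounds\<close>

text \<open>
  Such a set resolves two vertices above different leaves because it meets one of their fibres, and
  two vertices above the same vertex of the star by any of its elements. The hypotheses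
  \<open>partner\<close> and \<open>missed\<close> exclude the confusions of a centre with a leaf.
\<close>

lemma resolving_transversal:
  assumes M: "M \<subseteq> L" "M \<noteq> {}" and s: "s ` M \<subseteq> {a, b}"
    and unique: "\<And>l m. l \<in> L - M \<Longrightarrow> m \<in> L - M \<Longrightarrow> l = m"
    and partner: "\<And>l. l \<in> M \<Longrightarrow> \<exists>m\<in>M. m \<noteq> l \<and> s m = s l"
    and missed: "M \<noteq> L \<Longrightarrow> s ` M = {a, b}"
  shows "resolving_set (G \<box> H) ((\<lambda>l. (s l, l)) ` M)"
proof -
  have same_fibre: "x = y"
    if "x \<in> {a, b}" "y \<in> {a, b}" "\<And>m. m \<in> M \<Longrightarrow> prism_dist (x, p) (s m, m) = prism_dist (y, p) (s m, m)"
    for x y p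
  proof -
    obtain m where "m \<in> M" using M by blast
    then show ?thesis using that(3)[of m] that(1,2) s ab
      by (force simp: prism_dist_def split: if_splits)
  qed
  have leaves: "l = m"
    if lm: "l \<in> L" "m \<in> L" and eq: "\<And>r. r \<in> M \<Longrightarrow> prism_dist (x, l) (s r, r) = prism_dist (y, m) (s r, r)"
    for x y l m
  proof (rule ccontr)
    assume "l \<noteq> m"
    then consider "l \<in> M" | "m \<in> M" using unique[of l m] lm by blast
    then show False
      by cases (use eq[of l] eq[of m] \<open>l \<noteq> m\<close> lm cL in
        \<open>auto simp: prism_dist_def star_dist_def of_bool_def split: if_splits\<close>)
  qed
  have centre: False
    if x: "x \<in> {a, b}" and y: "y \<in> {a, b}" and l: "l \<in> L"
      and eq: "\<And>r. r \<in> M \<Longrightarrow> prism_dist (x, c) (s r, r) = prism_dist (y, l) (s r, r)" for x y l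
  proof -
    have other: "s r = y" if "r \<in> M" "r \<noteq> l" for r
      using eq[OF that(1)] that M cL l
      by (auto simp: prism_dist_def star_dist_def of_bool_def split: if_splits)
    show False
    proof (cases "l \<in> M")
      case True
      then have "s l \<noteq> y"
        using eq[OF True] cL l by (auto simp: prism_dist_def star_dist_def of_bool_def split: if_splits)
      then show False using partner[OF True] other by force
    next
      case False
      then have "s ` M \<subseteq> {y}" using other by auto
      moreover have "s ` M = {a, b}" using missed False l by blast
      ultimately show False using ab by auto
    qed
  qed
  show ?thesis
    unfolding resolving_prism_iff
  proof (intro conjI ballI impI)
    show "(\<lambda>l. (s l, l)) ` M \<subseteq> {a, b} \<times> insert c L" using M s by auto
  next
    fix u v assume u: "u \<in> {a, b} \<times> insert c L" and v: "v \<in> {a, b} \<times> insert c L"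
      and eq: "\<forall>w\<in>(\<lambda>l. (s l, l)) ` M. prism_dist u w = prism_dist v w"
    obtain x p where xp: "u = (x, p)" "x \<in> {a, b}" "p \<in> insert c L" using u by auto
    obtain y q where yq: "v = (y, q)" "y \<in> {a, b}" "q \<in> insert c L" using v by auto
    have eq': "prism_dist (x, p) (s r, r) = prism_dist (y, q) (s r, r)" if "r \<in> M" for r
      using eq that xp(1) yq(1) by auto
    have "p = q"
      using xp yq eq' leaves[of p q x y] centre[of x y q] centre[of y x p] by (metis insert_iff)
    then show "u = v" using same_fibre[of x y p] eq' xp yq by simp
  qed
qed

lemma card_transversal: "card ((\<lambda>l. (s l, l)) ` M) = card M"
  by (intro card_image) (auto simp: inj_on_def)

lemma resolving_one_layer:
  assumes "2 \<le> card L"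
  shows "resolving_set (G \<box> H) ((\<lambda>l. (a, l)) ` L)"
proof (rule resolving_transversal)
  fix l assume "l \<in> L"
  have "\<not> L \<subseteq> {l}" using assms card_mono[of "{l}" L] by auto
  then show "\<exists>m\<in>L. m \<noteq> l \<and> a = a" by blast
qed (use assms in auto)

lemma ex_small_resolving:
  assumes "5 \<le> card L"
  shows "\<exists>W. resolving_set (G \<box> H) W \<and> card W = card L - 1"
proof -
  \<comment> \<open>\<open>l0\<close> is the missed leaf, \<open>l1\<close> and \<open>l2\<close> are used in layer \<open>a\<close>; at least \<open>l3\<close> and \<open>l4\<close> remain for \<open>b\<close>.\<close>
  obtain T where T: "T \<subseteq> L" "card T = 5" using assms by (meson obtain_subset_with_card_n)
  obtain l0 l1 l2 l3 l4 where l: "T = {l0, l1, l2, l3, l4}" "distinct [l0, l1, l2, l3, l4]"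
  proof -
    obtain ls where ls: "set ls = T" "distinct ls"
      using finite_distinct_list finite_subset[OF T(1) finL] by blast
    then have "length ls = 5" using T(2) distinct_card by force
    then obtain l0 l1 l2 l3 l4 where "ls = [l0, l1, l2, l3, l4]"
      by (auto simp: length_Suc_conv numeral_eq_Suc)
    then show ?thesis using that ls by auto
  qed
  let ?M = "L - {l0}" and ?s = "\<lambda>l. if l \<in> {l1, l2} then a else b"
  have "resolving_set (G \<box> H) ((\<lambda>l. (?s l, l)) ` ?M)"
  proof (rule resolving_transversal)
    fix r assume "r \<in> ?M"
    \<comment> \<open>\<open>l1\<close> and \<open>l2\<close> are partners, and so are \<open>l3\<close> and \<open>l4\<close>; any other leaf lies in layer \<open>b\<close>, with \<open>l3\<close>\<close>
    let ?m = "if r = l1 then l2 else if r = l2 then l1 else if r = l3 then l4 else l3"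
    show "\<exists>m\<in>?M. m \<noteq> r \<and> ?s m = ?s r"
      using T l by (intro bexI[of _ ?m]) auto
  next
    have "a \<in> ?s ` ?M" using T l by (intro image_eqI[of _ _ l1]) auto
    moreover have "b \<in> ?s ` ?M" using T l by (intro image_eqI[of _ _ l3]) auto
    ultimately show "?s ` ?M = {a, b}" by (intro equalityI image_subsetI) simp_all
  next
    show "?M \<noteq> {}" using T l by auto
  qed auto
  moreover have "card ?M = card L - 1" using T l finL by simp
  then have "card ((\<lambda>l. (?s l, l)) ` ?M) = card L - 1" by (simp only: card_transversal)
  ultimately show ?thesis by (intro exI conjI)
qed

lemma resolving_edge:
  assumes "L = {l}"
  shows "resolving_set (G \<box> H) {(a, c), (a, l)}"
  using ab cL assms by (auto simp: resolving_prism_iff prism_dist_def star_dist_def)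

lemma metric_dim_prism:
  assumes "L \<noteq> {}"
  shows "metric_dim (G \<box> H) = (if card L = 1 then 2 else if card L \<le> 4 then card L else card L - 1)"
proof -
  have "0 < card L" using assms finL by (simp add: card_gt_0_iff)
  then consider "card L = 1" | "2 \<le> card L" "card L \<le> 4" | "5 \<le> card L" by linarith
  then show ?thesis
  proof cases
    case 1
    then obtain l where l: "L = {l}" by (auto simp: card_1_singleton_iff)
    have "metric_dim (G \<box> H) = 2"
      using l cL by (intro metric_dim_eqI[OF resolving_edge[OF l] _ card_resolving_ge_2]) auto
    then show ?thesis using 1 by simp
  next
    case 2
    have "metric_dim (G \<box> H) = card L"
    proof (rule metric_dim_eqI[OF resolving_one_layer[OF 2(1)] card_transversal])
      fix V assume V: "resolving_set (G \<box> H) V"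
      show "card L \<le> card V"
        using card_resolving_ge[OF V] five_leaves[OF V assms] 2 by linarith
    qed
    then show ?thesis using 2 by simp
  next
    case 3
    obtain W where "resolving_set (G \<box> H) W" "card W = card L - 1"
      using ex_small_resolving[OF 3] by blast
    then have "metric_dim (G \<box> H) = card L - 1"
      using card_resolving_ge by (rule metric_dim_eqI)
    then show ?thesis using 3 by simp
  qed
qed

end

theorem theorem2:
  fixes G :: "'a pair_pre_digraph" and H :: "'b pair_pre_digraph" and n :: nat
  assumes "n \<ge> 1"
    and "K\<^bsub>1,1\<^esub> (with_proj G)"
    and "K\<^bsub>1,n\<^esub> (with_proj H)"
  shows "metric_dim (G \<box> H) = (if n = 1 then 2 else if n \<le> 4 then n else n - 1)"
proof -
  obtain A B where AB: "pverts G = A \<union> B" "A \<inter> B = {}" "card A = 1" "card B = 1"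
    "parcs G = A \<times> B \<union> B \<times> A"
    using assms(2) unfolding complete_bipartite_digraph_pair_def by blast
  obtain a b where ab: "A = {a}" "B = {b}" using AB by (auto simp: card_1_singleton_iff)
  obtain C L where CL: "finite (pverts H)" "pverts H = C \<union> L" "C \<inter> L = {}" "card C = 1" "card L = n"
    "parcs H = C \<times> L \<union> L \<times> C"
    using assms(3) unfolding complete_bipartite_digraph_pair_def by blast
  obtain c where c: "C = {c}" using CL by (auto simp: card_1_singleton_iff)
  interpret star_prism G H a b c L
    using AB ab CL c by unfold_locales auto
  have "L \<noteq> {}" using CL assms(1) by auto
  from metric_dim_prism[OF this] show ?thesis by (simp only: CL)
qed

end
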